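(* Let $B^{H_1}$ and $\widetilde B^{H_2}$ be fractional Brownian motions on $[0,1]$ (with continuous sample paths) with Hurst indices $H_1,H_2\in(0,1)$. Then the following are equivalent: (i) $H_1+H_2>1$. (ii) There exist $p,q>1$ with $\frac1p+\frac1q=1$ such that $B^{H_1}\in\mathcal E^p$ and $\widetilde B^{H_2}\in\mathcal E^q$ almost surely. In this case, the Faber--Schauder integrals $I_{B^{H_1},\widetilde B^{H_2}}$ and $I_{\widetilde B^{H_2},B^{H_1}}$ exist on $[0,1]$ almost surely.
   Context: A fractional Brownian motion (fBM) with Hurst index $H\in(0,1)$ on $[0,1]$ is a centered Gaussian process with covariance $\mathbb E[B^H_sB^H_t]=\frac12(s^{2H}+t^{2H}-|t-s|^{2H})$, $s,t\in[0,1]$; the continuous modification is used. $C([0,1])$ denotes the real-valued continuous functions on $[0,1]$, $\|\cdot\|_\infty$ the uniform norm. $\mathbb N_0=\{0,1,2,\dots\}$, $\mathbb N_{-1}=\{-1,0,1,\dots\}$. For $n\in\mathbb N_0$: $t_{n,k}=k2^{-n}$ for $0\le k\le 2^n$, $\mathbb T_n=\{t_{n,k}:0\le k\le 2^n\}$, $\mathbb T=\bigcup_{n\ge0}\mathbb T_n$, $I_n=\{0,\dots,2^n-1\}$; for $t\in\mathbb T$, $\ell(t)=\min\{m\ge0:t\in\mathbb T_m\}$. Dyadic left sums: for $f,g\in C([0,1])$, $t\in\mathbb T$, $n\ge\ell(t)$, $$S_n^L(t;f,g)=\sum_{k=0}^{2^nt-1}f(t_{n,k})\big(g(t_{n,k+1})-g(t_{n,k})\big)$$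 (empty sum $=0$). The dyadic integral over $[0,t]$ exists if $(S_n^L(t;f,g))_{n\ge\ell(t)}$ converges, and its limit is denoted $I^{\mathbb T}_{f,g}(t)$. Faber--Schauder integral: if $I^{\mathbb T}_{f,g}(t)$ exists for every $t\in\mathbb T$ and the map $I^{\mathbb T}_{f,g}:\mathbb T\to\mathbb R$ admits a (necessarily unique) continuous extension to $[0,1]$, this extension is denoted $I_{f,g}:[0,1]\to\mathbb R$ and one says that the Faber--Schauder integral $I_{f,g}$ exists on $[0,1]$. For processes this is understood pathwise. Faber--Schauder coefficients of $f\in C([0,1])$: $\theta^f_{-1,0}=f(1)-f(0)$, and for $n\ge0$, $k\in I_n$, $\theta^f_{n,k}=2^{n/2}\big(2f(t_{n+1,2k+1})-f(t_{n,k})-f(t_{n,k+1})\big)$. Level energies ($p>1$): $\zeta_f^{(p)}(-1)=2^{1-\frac1p}|\theta^f_{-1,0}|$ and $\zeta_f^{(p)}(n)=\big(2^{-np/2}\sum_{k\in I_n}|\theta^f_{n,k}|^p\big)^{1/p}$ for $n\ge0$. Schauder tail sequence (of a path $f$; not to be confused with the Hurst indices): $H_f(n)=\sum_{m=n}^\infty 2^{-m/2}\sup_{k\in I_m}|\theta^f_{m,k}|\in[0,\infty]$ for $n\ge0$. Energy space ($p>1$): $\|f\|_{\mathcal E^p}=\|f\|_\infty+\|\zeta_f^{(p)}\|_{\ell^p(\mathbb N_{-1})}+\|H_f\|_{\ell^p(\mathbb N_0)}$ and $\mathcal E^p=\{f\in C([0,1]):\|f\|_{\mathcal E^p}<\infty\}$.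 *)

theory Defs
  imports "HOL-Probability.Probability"
begin

section \<open>Dyadic points\<close>

definition dyadic :: "nat \<Rightarrow> nat \<Rightarrow> real"
  where "dyadic n k = real k / 2 ^ n"

definition dyadic_grid :: "nat \<Rightarrow> real set"
  where "dyadic_grid n = {dyadic n k |k. k \<le> 2 ^ n}"

definition dyadics :: "real set"
  where "dyadics = (\<Union>n. dyadic_grid n)"

definition dyadic_level :: "real \<Rightarrow> nat"
  where "dyadic_level t = (LEAST m. t \<in> dyadic_grid m)"


section \<open>Dyadic and Faber--Schauder integrals\<close>

text \<open>
  Elements of $C([0,1])$ are represented by functions \<open>real \<Rightarrow> real\<close> of which only the values
  on \<open>{0..1}\<close> are ever used.
  In the next definition, $2^n t$ is a natural number whenever \<open>t\<close> is a dyadic point of level at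
  most \<open>n\<close>, so the floor is exact there.
\<close>

definition dyadic_left_sum :: "nat \<Rightarrow> real \<Rightarrow> (real \<Rightarrow> real) \<Rightarrow> (real \<Rightarrow> real) \<Rightarrow> real"
  where "dyadic_left_sum n t f g =
    (\<Sum>k<nat \<lfloor>2 ^ n * t\<rfloor>. f (dyadic n k) * (g (dyadic n (k + 1)) - g (dyadic n k)))"

text \<open>The index shift by the level of \<open>t\<close> expresses that the sequence starts at $n = \ell(t)$.\<close>

definition dyadic_integral_exists :: "(real \<Rightarrow> real) \<Rightarrow> (real \<Rightarrow> real) \<Rightarrow> real \<Rightarrow> bool"
  where "dyadic_integral_exists f g t \<longleftrightarrow>
    convergent (\<lambda>j. dyadic_left_sum (dyadic_level t + j) t f g)"

definition dyadic_integral :: "(real \<Rightarrow> real) \<Rightarrow> (real \<Rightarrow> real) \<Rightarrow> real \<Rightarrow> real"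
  where "dyadic_integral f g t = lim (\<lambda>j. dyadic_left_sum (dyadic_level t + j) t f g)"

definition faber_schauder_integral_exists :: "(real \<Rightarrow> real) \<Rightarrow> (real \<Rightarrow> real) \<Rightarrow> bool"
  where "faber_schauder_integral_exists f g \<longleftrightarrow>
    (\<forall>t\<in>dyadics. dyadic_integral_exists f g t) \<and>
    (\<exists>F. continuous_on {0..1} F \<and> (\<forall>t\<in>dyadics. F t = dyadic_integral f g t))"


section \<open>Energy spaces\<close>

text \<open>
  Levels range over the integers $n \ge -1$; level $-1$ has the single index $k = 0$.
\<close>

definition schauder_coeff :: "(real \<Rightarrow> real) \<Rightarrow> int \<Rightarrow> nat \<Rightarrow> real"
  where "schauder_coeff f n k =
    (if n = -1 then f 1 - f 0
     else 2 powr (of_int n / 2) *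
       (2 * f (dyadic (nat n + 1) (2 * k + 1)) - f (dyadic (nat n) k) - f (dyadic (nat n) (k + 1))))"

definition level_energy :: "real \<Rightarrow> (real \<Rightarrow> real) \<Rightarrow> int \<Rightarrow> real"
  where "level_energy p f n =
    (if n = -1 then 2 powr (1 - 1 / p) * \<bar>schauder_coeff f (-1) 0\<bar>
     else (2 powr (- (of_int n * p / 2)) * (\<Sum>k<2 ^ nat n. \<bar>schauder_coeff f n k\<bar> powr p)) powr (1 / p))"

text \<open>Infinite sums of extended nonnegative reals always exist, with value \<open>\<infinity>\<close> if they diverge.\<close>

definition schauder_tail :: "(real \<Rightarrow> real) \<Rightarrow> nat \<Rightarrow> ennreal"
  where "schauder_tail f n =
    (\<Sum>\<^sub>\<infinity>m\<in>{n..}. ennreal (2 powr (- (real m / 2)) * (SUP k\<in>{..<2 ^ m}. \<bar>schauder_coeff f (int m) k\<bar>)))"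

text \<open>Real powers on $[0,\infty]$, for exponents \<open>r > 0\<close> only.\<close>

definition ennreal_rpow :: "ennreal \<Rightarrow> real \<Rightarrow> ennreal"
  where "ennreal_rpow x r = (if x = \<infinity> then \<infinity> else ennreal (enn2real x powr r))"

definition lp_norm :: "real \<Rightarrow> 'i set \<Rightarrow> ('i \<Rightarrow> ennreal) \<Rightarrow> ennreal"
  where "lp_norm p A a = ennreal_rpow (\<Sum>\<^sub>\<infinity>i\<in>A. ennreal_rpow (a i) p) (1 / p)"

definition energy_norm :: "real \<Rightarrow> (real \<Rightarrow> real) \<Rightarrow> ennreal"
  where "energy_norm p f =
    (SUP t\<in>{0..1}. ennreal \<bar>f t\<bar>)
    + lp_norm p {-1..} (\<lambda>n. ennreal (level_energy p f n))
    + lp_norm p UNIV (schauder_tail f)"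

definition energy_space :: "real \<Rightarrow> (real \<Rightarrow> real) set"
  where "energy_space p = {f. continuous_on {0..1} f \<and> energy_norm p f < \<infinity>}"


section \<open>Fractional Brownian motion\<close>

text \<open>Point masses count as (degenerate) Gaussian distributions.\<close>

definition gaussian_variable :: "'w measure \<Rightarrow> ('w \<Rightarrow> real) \<Rightarrow> bool"
  where "gaussian_variable M Y \<longleftrightarrow>
    (\<exists>\<mu> \<sigma>. \<sigma> > 0 \<and> distributed M lborel Y (normal_density \<mu> \<sigma>)) \<or>
    (\<exists>\<mu>. Y \<in> borel_measurable M \<and> (AE \<omega> in M. Y \<omega> = \<mu>))"

definition centered_gaussian_process :: "'w measure \<Rightarrow> real set \<Rightarrow> (real \<Rightarrow> 'w \<Rightarrow> real) \<Rightarrow> bool"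
  where "centered_gaussian_process M T X \<longleftrightarrow>
    (\<forall>F c. finite F \<and> F \<subseteq> T \<longrightarrow> gaussian_variable M (\<lambda>\<omega>. \<Sum>t\<in>F. c t * X t \<omega>)) \<and>
    (\<forall>t\<in>T. (\<integral>\<omega>. X t \<omega> \<partial>M) = 0)"

definition fractional_brownian_motion :: "'w measure \<Rightarrow> real \<Rightarrow> (real \<Rightarrow> 'w \<Rightarrow> real) \<Rightarrow> bool"
  where "fractional_brownian_motion M H X \<longleftrightarrow>
    centered_gaussian_process M {0..1} X \<and>
    (\<forall>s\<in>{0..1}. \<forall>t\<in>{0..1}. (\<integral>\<omega>. X s \<omega> * X t \<omega> \<partial>M) =
       (s powr (2 * H) + t powr (2 * H) - \<bar>t - s\<bar> powr (2 * H)) / 2)"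

definition sample_path :: "(real \<Rightarrow> 'w \<Rightarrow> real) \<Rightarrow> 'w \<Rightarrow> real \<Rightarrow> real"
  where "sample_path X \<omega> = (\<lambda>t. X t \<omega>)"

end

theory Submission
  imports Defs
begin

text \<open>
  The bridge between the two conditions is a single scaling fact: for a fractional Brownian motion
  of Hurst index \<open>H\<close>, membership of the paths in the energy space of exponent \<open>p\<close> is governed by
  the sign of $Hp - 1$. Paths belong to it almost surely when $Hp > 1$
  (\<open>AE_dyadic_variation_geometric\<close> with \<open>energy_space_if_variation_geometric\<close>), and they can do so
  almost surely only when $Hp > 1$ (\<open>exponent_gt_if_AE_energy_space\<close>). For conjugate exponents the
  two conditions $H_1 > 1/p$ and $H_2 > 1/q$ add up to $H_1 + H_2 > 1$; conversely, if
  $H_1 + H_2 > 1$ there is room for a number $u = 1/p$ with $1 - H_2 < u < H_1$.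

  \<^emph>\<open>Sufficiency.\<close> An increment over a dyadic interval of level \<open>n\<close> is $2^{-nH}$ times a standard
  normal variable, so the sum of the \<open>p\<close>-th powers of all $2^n$ increments has expectation
  proportional to $2^{n(1-Hp)}$. When this decays geometrically, almost every path has a
  geometrically decaying dyadic \<open>p\<close>-variation. From here on the argument is
  pathwise. Up to normalisation, a Schauder coefficient is a difference of two consecutive
  increments, so the level energies decay geometrically as well; each of them dominates the supremum
  of the coefficients of its level, so the Schauder tails are bounded by geometric tails.

  \<^emph>\<open>Necessity.\<close> A path in the energy space has level energies tending to zero. If $Hp \<le> 1$, then
  the \<open>p\<close>-th power of the energy of level \<open>n\<close> is at least a constant times the average of
  $|G|^p$ over the $2^n$ normalised second differences \<open>G\<close> of that level, all of them
  standard normal. Truncating $|G|^p$ at one yields averages that are bounded by one and have the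
  same positive expectation at every level; by dominated convergence they cannot tend to zero
  almost surely, even in the critical case $Hp = 1$.

  \<^emph>\<open>Integrals.\<close> Passing from level \<open>n\<close> to level $n + 1$ changes a dyadic left sum by a sum of products
  of neighbouring increments of \<open>f\<close> and \<open>g\<close>. Young's inequality bounds it by the \<open>p\<close>-variation of
  \<open>f\<close> plus the \<open>q\<close>-variation of \<open>g\<close>. If the left sums are
  extended to continuous functions of the upper limit, the same estimate is uniform in that limit
  up to one boundary term, so these functions converge uniformly to a continuous function, which is
  the integral (\<open>faber_schauder_integral_exists_if_variation_geometric\<close>).
\<close>

section \<open>Dyadic points and geometric sums\<close>

lemma dyadic_double: "dyadic (Suc n) (2 * k) = dyadic n k"
  by (simp add: dyadic_def)

lemma dyadic_nonneg: "0 \<le> dyadic n k"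
  by (simp add: dyadic_def)

lemma dyadic_diff: "dyadic n (k + 1) - dyadic n k = 1 / 2 ^ n"
  by (simp add: dyadic_def field_simps)

lemma dyadic_le_iff: "dyadic n j \<le> dyadic n k \<longleftrightarrow> j \<le> k"
  by (simp add: dyadic_def divide_le_cancel)

lemma dyadic_le_1: "k \<le> 2 ^ n \<Longrightarrow> dyadic n k \<le> 1"
  using of_nat_mono[of k "2 ^ n", where 'a = real] by (simp add: dyadic_def)

lemma dyadic_midpoint_bounds:
  "dyadic n k < dyadic (Suc n) (2 * k + 1)" "dyadic (Suc n) (2 * k + 1) < dyadic n (k + 1)"
  by (auto simp: dyadic_def field_simps)

lemma sum_lessThan_double: "(\<Sum>k<2 * N. h k) = (\<Sum>k<N. h (2 * k) + h (2 * k + 1 :: nat) :: 'a::comm_monoid_add)"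
  by (induction N) (simp_all add: add.assoc)

lemma sum_powers_le_geometric_tail:
  fixes r :: real
  assumes "0 \<le> r" "r < 1" "finite F" "F \<subseteq> {n..}"
  shows "(\<Sum>m\<in>F. r ^ m) \<le> r ^ n / (1 - r)"
proof -
  have "(\<Sum>m\<in>F. r ^ m) \<le> (\<Sum>m\<in>{n..n + Max (insert 0 F)}. r ^ m)"
    using assms by (intro sum_mono2) (auto intro!: trans_le_add2 Max_ge)
  also have "\<dots> = (r ^ n - r ^ (Suc (n + Max (insert 0 F)))) / (1 - r)"
    using assms by (simp add: sum_gp)
  also have "\<dots> \<le> r ^ n / (1 - r)"
    using assms by (intro divide_right_mono) auto
  finally show ?thesis .
qed

section \<open>Finiteness of norms of extended nonnegative sequences\<close>

lemma ennreal_rpow_ennreal: "0 \<le> x \<Longrightarrow> ennreal_rpow (ennreal x) p = ennreal (x powr p)"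
  by (simp add: ennreal_rpow_def)

lemma ennreal_rpow_mono: "0 < p \<Longrightarrow> x \<le> y \<Longrightarrow> ennreal_rpow x p \<le> ennreal_rpow y p"
  unfolding ennreal_rpow_def
  by (auto simp: top_unique less_top intro!: ennreal_leI powr_mono2 enn2real_mono)

lemma ennreal_rpow_less_top_iff: "ennreal_rpow x p < top \<longleftrightarrow> x < top"
  by (auto simp: ennreal_rpow_def less_top)

lemma lp_norm_finite_iff: "lp_norm p A a < top \<longleftrightarrow> (\<Sum>\<^sub>\<infinity>i\<in>A. ennreal_rpow (a i) p) < top"
  by (simp add: lp_norm_def ennreal_rpow_less_top_iff)

lemma infsum_ennreal_le:
  fixes a :: "'i \<Rightarrow> ennreal"
  assumes "\<And>F. finite F \<Longrightarrow> F \<subseteq> A \<Longrightarrow> sum a F \<le> b"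
  shows "infsum a A \<le> b"
  by (rule infsum_le_finite_sums) (auto intro: assms nonneg_summable_on_complete)

lemma sum_le_infsum_ennreal:
  fixes a :: "'i \<Rightarrow> ennreal"
  assumes "finite F" "F \<subseteq> A"
  shows "sum a F \<le> infsum a A"
proof -
  have "sum a F = infsum a F" using assms by simp
  also have "\<dots> \<le> infsum a A"
    using assms by (intro infsum_mono_neutral nonneg_summable_on_complete) auto
  finally show ?thesis .
qed

text \<open>
  The injection \<open>h\<close> enumerates the index set by natural numbers, so that one criterion serves both
  the sequences starting at \<open>0\<close> and those starting at \<open>-1\<close>.
\<close>

lemma lp_norm_finite_geometric:
  assumes "0 < p" "0 \<le> r" "r < 1" "0 \<le> D" "inj_on h A"
    and "\<And>i. i \<in> A \<Longrightarrow> a i \<le> ennreal (b i)" "\<And>i. i \<in> A \<Longrightarrow> 0 \<le> b i"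
    and "\<And>i. i \<in> A \<Longrightarrow> b i powr p \<le> D * r ^ h i"
  shows "lp_norm p A a < top"
proof -
  have "(\<Sum>\<^sub>\<infinity>i\<in>A. ennreal_rpow (a i) p) \<le> ennreal (D * (1 / (1 - r)))"
  proof (rule infsum_ennreal_le)
    fix F assume F: "finite F" "F \<subseteq> A"
    have "(\<Sum>i\<in>F. ennreal_rpow (a i) p) \<le> (\<Sum>i\<in>F. ennreal (D * r ^ h i))"
    proof (rule sum_mono)
      fix i assume "i \<in> F"
      with F have i: "i \<in> A" by auto
      have "ennreal_rpow (a i) p \<le> ennreal_rpow (ennreal (b i)) p"
        using assms i by (intro ennreal_rpow_mono) auto
      also have "\<dots> \<le> ennreal (D * r ^ h i)"
        using assms i by (simp add: ennreal_rpow_ennreal ennreal_leI)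
      finally show "ennreal_rpow (a i) p \<le> ennreal (D * r ^ h i)" .
    qed
    also have "\<dots> = ennreal (D * (\<Sum>i\<in>F. r ^ h i))"
      using assms by (subst sum_ennreal) (auto simp: sum_distrib_left)
    also have "(\<Sum>i\<in>F. r ^ h i) = (\<Sum>m\<in>h ` F. r ^ m)"
      using assms F by (subst sum.reindex) (auto intro: inj_on_subset)
    also have "ennreal (D * (\<Sum>m\<in>h ` F. r ^ m)) \<le> ennreal (D * (1 / (1 - r)))"
      using sum_powers_le_geometric_tail[of r "h ` F" 0] assms F
      by (intro ennreal_leI mult_left_mono) auto
    finally show "(\<Sum>i\<in>F. ennreal_rpow (a i) p) \<le> ennreal (D * (1 / (1 - r)))" .
  qed
  then show ?thesis
    by (simp add: lp_norm_finite_iff order.strict_trans1)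
qed

section \<open>Paths of geometrically decaying dyadic variation\<close>

definition dyadic_variation :: "real \<Rightarrow> (real \<Rightarrow> real) \<Rightarrow> nat \<Rightarrow> real"
  where "dyadic_variation p f n = (\<Sum>k<2 ^ n. \<bar>f (dyadic n (k + 1)) - f (dyadic n k)\<bar> powr p)"

lemma dyadic_variation_nonneg: "0 \<le> dyadic_variation p f n"
  by (simp add: dyadic_variation_def sum_nonneg)

text \<open>
  The Schauder coefficients stripped of the factor $2^{n/2}$. The level energies become plain
  \<open>p\<close>-norms in these quantities, all powers of two cancelling.
\<close>

definition second_difference :: "(real \<Rightarrow> real) \<Rightarrow> nat \<Rightarrow> nat \<Rightarrow> real"
  where "second_difference f n k =
    2 * f (dyadic (n + 1) (2 * k + 1)) - f (dyadic n k) - f (dyadic n (k + 1))"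

lemma schauder_coeff_eq:
  "schauder_coeff f (int n) k = 2 powr (real n / 2) * second_difference f n k"
  by (simp add: schauder_coeff_def second_difference_def)

lemma level_energy_eq:
  assumes "0 < p"
  shows "level_energy p f (int n) = (\<Sum>k<2 ^ n. \<bar>second_difference f n k\<bar> powr p) powr (1 / p)"
proof -
  have "2 powr (- (real n * p / 2)) * (\<Sum>k<2 ^ n. \<bar>schauder_coeff f (int n) k\<bar> powr p)
      = (\<Sum>k<2 ^ n. \<bar>second_difference f n k\<bar> powr p)"
    by (simp add: schauder_coeff_eq abs_mult powr_mult powr_powr sum_distrib_left
        mult.assoc[symmetric] flip: powr_add)
  then show ?thesis
    by (simp add: level_energy_def)
qed

lemma level_energy_powr:
  assumes "0 < p"
  shows "level_energy p f (int n) powr p = (\<Sum>k<2 ^ n. \<bar>second_difference f n k\<bar> powr p)"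
  using assms by (simp add: level_energy_eq powr_powr sum_nonneg)

lemma level_energy_nonneg: "0 \<le> level_energy p f n"
  by (simp add: level_energy_def)

lemma second_difference_le_level_energy:
  assumes "0 < p" "k < 2 ^ n"
  shows "\<bar>second_difference f n k\<bar> \<le> level_energy p f (int n)"
proof -
  have "\<bar>second_difference f n k\<bar> powr p \<le> (\<Sum>k<2 ^ n. \<bar>second_difference f n k\<bar> powr p)"
    using assms by (intro member_le_sum) auto
  then have "(\<bar>second_difference f n k\<bar> powr p) powr (1 / p) \<le> level_energy p f (int n)"
    using assms unfolding level_energy_eq[OF assms(1)] by (intro powr_mono2) auto
  then show ?thesis using assms by (simp add: powr_powr)
qed

lemma increment_le_dyadic_variation:
  assumes "0 < p" "k < 2 ^ n"
  shows "\<bar>f (dyadic n (k + 1)) - f (dyadic n k)\<bar> \<le> dyadic_variation p f n powr (1 / p)"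
proof -
  have "\<bar>f (dyadic n (k + 1)) - f (dyadic n k)\<bar> powr p \<le> dyadic_variation p f n"
    unfolding dyadic_variation_def using assms by (intro member_le_sum) auto
  then have "(\<bar>f (dyadic n (k + 1)) - f (dyadic n k)\<bar> powr p) powr (1 / p)
      \<le> dyadic_variation p f n powr (1 / p)"
    using assms by (intro powr_mono2) auto
  then show ?thesis using assms by (simp add: powr_powr)
qed

lemma abs_diff_powr_le:
  fixes x y :: real
  assumes "0 < p"
  shows "\<bar>x - y\<bar> powr p \<le> 2 powr p * (\<bar>x\<bar> powr p + \<bar>y\<bar> powr p)"
proof -
  have "\<bar>x - y\<bar> powr p \<le> (2 * max \<bar>x\<bar> \<bar>y\<bar>) powr p"
    using assms by (intro powr_mono2) auto
  also have "\<dots> = 2 powr p * (max \<bar>x\<bar> \<bar>y\<bar>) powr p"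
    by (simp add: powr_mult)
  also have "\<dots> \<le> 2 powr p * (\<bar>x\<bar> powr p + \<bar>y\<bar> powr p)"
    by (intro mult_left_mono) (auto simp: max_def)
  finally show ?thesis .
qed

text \<open>
  The second difference over an interval is the difference of the increments over its two halves,
  and these halves are exactly the intervals of the next level.
\<close>

lemma level_energy_le_dyadic_variation:
  assumes "0 < p"
  shows "level_energy p f (int n) powr p \<le> 2 powr p * dyadic_variation p f (Suc n)"
proof -
  let ?d = "\<lambda>k. f (dyadic (Suc n) (k + 1)) - f (dyadic (Suc n) k)"
  have "level_energy p f (int n) powr p
      \<le> (\<Sum>k<2 ^ n. 2 powr p * (\<bar>?d (2 * k)\<bar> powr p + \<bar>?d (2 * k + 1)\<bar> powr p))"
    unfolding level_energy_powr[OF assms]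
  proof (rule sum_mono)
    fix k
    have "second_difference f n k = ?d (2 * k) - ?d (2 * k + 1)"
      using dyadic_double[of n k] dyadic_double[of n "k + 1"] by (simp add: second_difference_def)
    then show "\<bar>second_difference f n k\<bar> powr p
        \<le> 2 powr p * (\<bar>?d (2 * k)\<bar> powr p + \<bar>?d (2 * k + 1)\<bar> powr p)"
      using abs_diff_powr_le[OF assms] by metis
  qed
  also have "\<dots> = 2 powr p * dyadic_variation p f (Suc n)"
    unfolding dyadic_variation_def power_Suc sum_lessThan_double by (simp add: sum_distrib_left)
  finally show ?thesis .
qed

text \<open>
  The largest term of a finite family is at most its \<open>p\<close>-norm, so the supremum over a level in the
  tail is controlled by the level energy.
\<close>

lemma schauder_tail_le_geometric:
  assumes "0 \<le> \<rho>" "\<rho> < 1" "0 \<le> K" "0 < p"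
    and energy: "\<And>m. level_energy p f (int m) \<le> K * \<rho> ^ m"
  shows "schauder_tail f n \<le> ennreal (K * (\<rho> ^ n / (1 - \<rho>)))"
  unfolding schauder_tail_def
proof (rule infsum_ennreal_le)
  fix F :: "nat set" assume F: "finite F" "F \<subseteq> {n..}"
  have "(\<Sum>m\<in>F. ennreal (2 powr - (real m / 2) * (SUP k\<in>{..<2 ^ m}. \<bar>schauder_coeff f (int m) k\<bar>)))
      \<le> (\<Sum>m\<in>F. ennreal (K * \<rho> ^ m))"
  proof (intro sum_mono ennreal_leI)
    fix m
    have "(SUP k\<in>{..<2 ^ m}. \<bar>schauder_coeff f (int m) k\<bar>) \<le> 2 powr (real m / 2) * (K * \<rho> ^ m)"
    proof (rule cSUP_least)
      fix k :: nat assume "k \<in> {..<2 ^ m}"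
      then show "\<bar>schauder_coeff f (int m) k\<bar> \<le> 2 powr (real m / 2) * (K * \<rho> ^ m)"
        using second_difference_le_level_energy[of p k m f] energy[of m] assms
        by (auto simp: schauder_coeff_eq abs_mult intro!: mult_left_mono intro: order_trans)
    qed (auto simp: lessThan_empty_iff)
    then have "2 powr - (real m / 2) * (SUP k\<in>{..<2 ^ m}. \<bar>schauder_coeff f (int m) k\<bar>)
        \<le> 2 powr - (real m / 2) * (2 powr (real m / 2) * (K * \<rho> ^ m))"
      by (intro mult_left_mono) auto
    then show "2 powr - (real m / 2) * (SUP k\<in>{..<2 ^ m}. \<bar>schauder_coeff f (int m) k\<bar>) \<le> K * \<rho> ^ m"
      by (simp add: mult.assoc[symmetric] flip: powr_add)
  qed
  also have "\<dots> = ennreal (K * (\<Sum>m\<in>F. \<rho> ^ m))"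
    using assms by (subst sum_ennreal) (auto simp: sum_distrib_left)
  also have "\<dots> \<le> ennreal (K * (\<rho> ^ n / (1 - \<rho>)))"
    using sum_powers_le_geometric_tail[of \<rho> F n] assms F by (intro ennreal_leI mult_left_mono) auto
  finally show "(\<Sum>m\<in>F. ennreal (2 powr - (real m / 2) * (SUP k\<in>{..<2 ^ m}. \<bar>schauder_coeff f (int m) k\<bar>)))
      \<le> ennreal (K * (\<rho> ^ n / (1 - \<rho>)))" .
qed

lemma powr_less_one_if_base_less_one:
  fixes r :: real
  assumes "0 < r" "r < 1" "0 < a"
  shows "r powr a < 1"
  using powr_less_mono2[of a r 1] assms by simp

lemma power_powr_swap:
  fixes r :: real
  assumes "0 < r"
  shows "(r ^ n) powr a = (r powr a) ^ n"
proof -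
  have "(r ^ n) powr a = r powr (real n * a)"
    using assms by (simp add: powr_realpow[symmetric] powr_powr del: powr_realpow)
  also have "\<dots> = (r powr a) powr real n"
    by (simp add: powr_powr mult.commute)
  finally show ?thesis
    using assms by (simp add: powr_realpow)
qed

theorem energy_space_if_variation_geometric:
  assumes cont: "continuous_on {0..1} f" and p: "0 < p" and r: "0 < r" "r < 1"
    and var: "\<And>n. dyadic_variation p f n \<le> C * r ^ n"
  shows "f \<in> energy_space p"
proof -
  have C: "0 \<le> C"
    using dyadic_variation_nonneg[of p f 0] var[of 0] by simp
  have energy: "level_energy p f (int n) powr p \<le> 2 powr p * C * r ^ Suc n" for n
  proof -
    have "level_energy p f (int n) powr p \<le> 2 powr p * dyadic_variation p f (Suc n)"
      by (rule level_energy_le_dyadic_variation[OF p])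
    also have "\<dots> \<le> 2 powr p * (C * r ^ Suc n)"
      by (intro mult_left_mono var) auto
    finally show ?thesis by (simp add: mult.assoc)
  qed
  define \<rho> where "\<rho> = r powr (1 / p)"
  define K where "K = (2 powr p * C) powr (1 / p)"
  have \<rho>: "0 < \<rho>" "\<rho> < 1"
    using r p by (auto simp: \<rho>_def powr_less_one_if_base_less_one)
  have "level_energy p f (int n) \<le> K * \<rho> ^ n" for n
  proof -
    have "2 powr p * C * r ^ Suc n \<le> 2 powr p * C * r ^ n"
      using C r by (intro mult_left_mono) (auto intro: mult_left_le_one_le)
    then have "(level_energy p f (int n) powr p) powr (1 / p) \<le> (2 powr p * C * r ^ n) powr (1 / p)"
      using order_trans[OF energy[of n]] p by (intro powr_mono2) auto
    then show ?thesis
      using p r C by (simp add: K_def \<rho>_def powr_powr level_energy_nonneg powr_mult power_powr_swap)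
  qed
  then have tail: "schauder_tail f n \<le> ennreal (K * (\<rho> ^ n / (1 - \<rho>)))" for n
    using \<rho> p by (intro schauder_tail_le_geometric[OF _ _ _ p]) (auto simp: K_def)
  have "lp_norm p UNIV (schauder_tail f) < top"
  proof (rule lp_norm_finite_geometric[where h = id])
    show "(K * (\<rho> ^ n / (1 - \<rho>))) powr p \<le> (K / (1 - \<rho>)) powr p * (r ^ id n)" for n
    proof -
      have "(K * (\<rho> ^ n / (1 - \<rho>))) = (K / (1 - \<rho>)) * \<rho> ^ n" by simp
      moreover have "(\<rho> ^ n) powr p = r ^ n"
        using \<rho> r p by (simp add: power_powr_swap) (simp add: \<rho>_def powr_powr)
      ultimately show ?thesis
        using \<rho> by (simp only: powr_mult K_def) (simp add: powr_mult)
    qed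
  qed (use tail p r \<rho> in \<open>auto simp: K_def\<close>)
  moreover have "lp_norm p {-1..} (\<lambda>n. ennreal (level_energy p f n)) < top"
  proof (rule lp_norm_finite_geometric[where h = "\<lambda>i. nat (i + 1)"])
    fix i :: int assume i: "i \<in> {-1..}"
    show "level_energy p f i powr p \<le> (level_energy p f (-1) powr p + 2 powr p * C) * r ^ nat (i + 1)"
    proof (cases "i = -1")
      case True
      then show ?thesis using C by simp
    next
      case False
      with i have "i = int (nat i)" by simp
      then obtain n where n: "i = int n" by blast
      then have "nat (i + 1) = Suc n" by simp
      with energy[of n] n r show ?thesis
        by (simp add: distrib_right add_increasing)
    qed
  qed (use p r C in \<open>auto simp: inj_on_def level_energy_nonneg\<close>)
  moreover have "(SUP t\<in>{0..1}. ennreal \<bar>f t\<bar>) < top"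
  proof -
    have "compact (f ` {0..1})"
      using cont by (intro compact_continuous_image) auto
    then obtain B where "\<forall>t\<in>{0..1}. \<bar>f t\<bar> \<le> B"
      by (auto dest!: compact_imp_bounded simp: bounded_iff)
    then have "(SUP t\<in>{0..1}. ennreal \<bar>f t\<bar>) \<le> ennreal B"
      by (intro SUP_least ennreal_leI) auto
    then show ?thesis by (simp add: order.strict_trans1)
  qed
  ultimately show ?thesis
    using cont by (simp add: energy_space_def energy_norm_def)
qed

text \<open>
  What finite energy contributes to the necessity argument: the \<open>p\<close>-th powers of
  the level energies are summable, hence tend to zero.
\<close>

theorem second_difference_sums_tendsto_0:
  assumes f: "f \<in> energy_space p" and p: "0 < p"
  shows "(\<lambda>n. \<Sum>k<2 ^ n. \<bar>second_difference f n k\<bar> powr p) \<longlonglongrightarrow> 0"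
proof -
  let ?Z = "\<lambda>n. \<Sum>k<2 ^ n. \<bar>second_difference f n k\<bar> powr p"
  let ?e = "\<lambda>i. ennreal_rpow (ennreal (level_energy p f i)) p"
  have fin: "infsum ?e {-1..} < top"
    using f by (simp add: energy_space_def energy_norm_def lp_norm_finite_iff)
  have "(\<Sum>n<N. ?Z n) \<le> enn2real (infsum ?e {-1..})" for N
  proof -
    have "ennreal (\<Sum>n<N. ?Z n) = (\<Sum>n<N. ?e (int n))"
      by (subst sum_ennreal[symmetric])
        (auto simp: ennreal_rpow_ennreal level_energy_nonneg level_energy_powr[OF p] sum_nonneg)
    also have "\<dots> = sum ?e (int ` {..<N})"
      by (subst sum.reindex) auto
    also have "\<dots> \<le> infsum ?e {-1..}"
      by (intro sum_le_infsum_ennreal) auto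
    finally show ?thesis
      using fin enn2real_mono[of "ennreal (\<Sum>n<N. ?Z n)" "infsum ?e {-1..}"] by (simp add: sum_nonneg)
  qed
  then have "(\<Sum>n\<le>N. ?Z n) \<le> enn2real (infsum ?e {-1..})" for N
    by (simp only: lessThan_Suc_atMost[symmetric])
  then have "summable ?Z"
    by (intro bounded_imp_summable[where B = "enn2real (infsum ?e {-1..})"]) (auto simp: sum_nonneg)
  then show ?thesis by (rule summable_LIMSEQ_zero)
qed

section \<open>The dyadic integral of two paths of geometrically decaying variation\<close>

text \<open>
  The left sum with integrator stopped at \<open>t\<close>: it makes sense for every real \<open>t\<close> in the unit
  interval, is continuous in \<open>t\<close>, and agrees with the dyadic left sum as soon as \<open>t\<close> is a grid point.
\<close>

definition left_sum_path :: "nat \<Rightarrow> (real \<Rightarrow> real) \<Rightarrow> (real \<Rightarrow> real) \<Rightarrow> real \<Rightarrow> real"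
  where "left_sum_path n f g t =
    (\<Sum>k<2 ^ n. f (dyadic n k) * (g (min t (dyadic n (k + 1))) - g (min t (dyadic n k))))"

lemma left_sum_path_eq:
  assumes "t \<in> dyadic_grid n"
  shows "left_sum_path n f g t = dyadic_left_sum n t f g"
proof -
  obtain j where j: "t = dyadic n j" "j \<le> 2 ^ n"
    using assms by (auto simp: dyadic_grid_def)
  have "nat \<lfloor>2 ^ n * t\<rfloor> = j"
    by (simp add: j dyadic_def)
  then have "dyadic_left_sum n t f g = (\<Sum>k<j. f (dyadic n k) * (g (dyadic n (k + 1)) - g (dyadic n k)))"
    by (simp add: dyadic_left_sum_def)
  also have "\<dots> = (\<Sum>k<j. f (dyadic n k) * (g (min t (dyadic n (k + 1))) - g (min t (dyadic n k))))"
    by (intro sum.cong) (auto simp: j min_def dyadic_le_iff le_Suc_eq)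
  also have "\<dots> = left_sum_path n f g t"
    unfolding left_sum_path_def using j
    by (intro sum.mono_neutral_left) (auto simp: min_def dyadic_le_iff)
  finally show ?thesis by simp
qed

lemma continuous_on_left_sum_path:
  assumes "continuous_on {0..1} g"
  shows "continuous_on {0..1} (left_sum_path n f g)"
  unfolding left_sum_path_def
  by (intro continuous_intros continuous_on_compose2[OF assms])
    (auto simp: dyadic_nonneg intro!: min.coboundedI1)

text \<open>
  On an interval with endpoints \<open>a\<close>, \<open>b\<close> and midpoint \<open>m\<close> the two left sums differ by
  $f(a)(g(m)-g(a)) + f(m)(g(b)-g(m)) - f(a)(g(b)-g(a)) = (f(m)-f(a))(g(b)-g(m))$.
\<close>

lemma left_sum_path_refine:
  "left_sum_path (Suc n) f g t - left_sum_path n f g t =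
    (\<Sum>k<2 ^ n. (f (dyadic (Suc n) (2 * k + 1)) - f (dyadic n k)) *
      (g (min t (dyadic n (k + 1))) - g (min t (dyadic (Suc n) (2 * k + 1)))))"
proof -
  have end_eq: "dyadic (Suc n) (2 * k + 1 + 1) = dyadic n (k + 1)" for k
    using dyadic_double[of n "k + 1"] by simp
  show ?thesis
    unfolding left_sum_path_def power_Suc sum_lessThan_double sum_subtractf[symmetric]
      end_eq dyadic_double
    by (intro sum.cong refl) (simp only: algebra_simps)
qed

text \<open>
  Young's inequality decouples the two paths; summed over the intervals of a level, each term on the
  right becomes a dyadic variation, and each of these decays geometrically by itself.
\<close>

lemma young_crude:
  fixes x y :: real
  assumes "p > 1" "q > 1" "1 / p + 1 / q = 1"
  shows "\<bar>x * y\<bar> \<le> \<bar>x\<bar> powr p + \<bar>y\<bar> powr q"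
proof -
  have "\<bar>x\<bar> * \<bar>y\<bar> \<le> \<bar>x\<bar> powr p / p + \<bar>y\<bar> powr q / q"
    using assms by (intro Youngs_inequality) auto
  also have "\<dots> \<le> \<bar>x\<bar> powr p + \<bar>y\<bar> powr q"
    using assms by (intro add_mono) (auto simp: divide_le_eq mult_left_mono mult_le_cancel_left1)
  finally show ?thesis by (simp add: abs_mult)
qed

text \<open>
  Intervals on the right of \<open>t\<close> contribute nothing and intervals on the left contribute full
  increments. At most one interval has \<open>t\<close> in the interior of its right half; there the increment of the
  stopped integrator is bounded only by the size of \<open>g\<close>, but the increment of \<open>f\<close> is small, which
  accounts for the last summand.
\<close>

lemma left_sum_path_refine_bound:
  assumes pq: "p > 1" "q > 1" "1 / p + 1 / q = 1"
    and t: "t \<in> {0..1}" and G: "\<And>s. s \<in> {0..1} \<Longrightarrow> \<bar>g s\<bar> \<le> G"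
  shows "\<bar>left_sum_path (Suc n) f g t - left_sum_path n f g t\<bar>
    \<le> dyadic_variation p f (Suc n) + dyadic_variation q g (Suc n)
      + 2 * G * dyadic_variation p f (Suc n) powr (1 / p)"
proof -
  let ?m = "\<lambda>k. dyadic (Suc n) (2 * k + 1)"
  let ?x = "\<lambda>k. f (?m k) - f (dyadic n k)" and ?y = "\<lambda>k. g (dyadic n (k + 1)) - g (?m k)"
  let ?w = "\<lambda>k. g (min t (dyadic n (k + 1))) - g (min t (?m k))"
  let ?V = "dyadic_variation p f (Suc n) powr (1 / p)"
  \<comment> \<open>index of the level-\<open>n\<close> interval containing \<open>t\<close>\<close>
  define j where "j = nat \<lfloor>2 ^ n * t\<rfloor>"
  have G0: "0 \<le> G" using G[of 0] by auto
  have end_eq: "dyadic (Suc n) (Suc (Suc (2 * k))) = dyadic n (Suc k)" for k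
    using dyadic_double[of n "k + 1"] by simp
  have summand_le: "\<bar>?x k * ?w k\<bar> \<le> \<bar>?x k\<bar> powr p + \<bar>?y k\<bar> powr q + (if k = j then 2 * G * ?V else 0)"
    if k: "k \<in> {..<2 ^ n}" for k
  proof -
    consider "t \<le> ?m k" | "dyadic n (k + 1) \<le> t" | "?m k < t" "t < dyadic n (k + 1)"
      by linarith
    then show ?thesis
    proof cases
      case 1
      then have "?w k = 0"
        using dyadic_midpoint_bounds(2)[of n k] by (simp add: min_def)
      then show ?thesis using G0 by simp
    next
      case 2
      then have "?w k = ?y k"
        using dyadic_midpoint_bounds(2)[of n k] by (simp add: min_def)
      moreover have "0 \<le> (if k = j then 2 * G * ?V else 0)"
        using G0 by simp
      ultimately show ?thesis using young_crude[OF pq, of "?x k" "?y k"] by simp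
    next
      case 3
      then have "dyadic n k < t" using dyadic_midpoint_bounds(1)[of n k] by linarith
      then have "real k \<le> 2 ^ n * t" "2 ^ n * t < real k + 1"
        using 3 by (auto simp: dyadic_def field_simps)
      then have "\<lfloor>2 ^ n * t\<rfloor> = int k" by (simp add: floor_eq_iff)
      then have kj: "k = j" by (simp add: j_def)
      have "2 * k < 2 ^ Suc n" using k by simp
      then have "\<bar>?x k\<bar> \<le> ?V"
        using increment_le_dyadic_variation[of p "2 * k" "Suc n" f] pq by (simp add: dyadic_double)
      moreover have "\<bar>?w k\<bar> \<le> 2 * G"
      proof -
        have "min t s \<in> {0..1}" if "0 \<le> s" for s using t that by auto
        from G[OF this[of "dyadic n (k + 1)"]] G[OF this[of "?m k"]]
        show ?thesis by (simp add: dyadic_nonneg)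
      qed
      ultimately have "\<bar>?x k * ?w k\<bar> \<le> ?V * (2 * G)"
        unfolding abs_mult by (intro mult_mono) auto
      then show ?thesis using kj by (auto simp: mult.commute intro: add_increasing)
    qed
  qed
  have "\<bar>left_sum_path (Suc n) f g t - left_sum_path n f g t\<bar> \<le> (\<Sum>k<2 ^ n. \<bar>?x k * ?w k\<bar>)"
    unfolding left_sum_path_refine by (rule sum_abs)
  also have "\<dots> \<le> (\<Sum>k<2 ^ n. \<bar>?x k\<bar> powr p + \<bar>?y k\<bar> powr q + (if k = j then 2 * G * ?V else 0))"
    by (rule sum_mono[OF summand_le])
  also have "\<dots> = (\<Sum>k<2 ^ n. \<bar>?x k\<bar> powr p) + (\<Sum>k<2 ^ n. \<bar>?y k\<bar> powr q)
      + (\<Sum>k<2 ^ n. if k = j then 2 * G * ?V else 0)"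
    by (simp add: sum.distrib)
  also have "\<dots> \<le> dyadic_variation p f (Suc n) + dyadic_variation q g (Suc n) + 2 * G * ?V"
  proof (intro add_mono)
    show "(\<Sum>k<2 ^ n. \<bar>?x k\<bar> powr p) \<le> dyadic_variation p f (Suc n)"
      unfolding dyadic_variation_def power_Suc sum_lessThan_double
      by (intro sum_mono) (simp add: dyadic_double)
    show "(\<Sum>k<2 ^ n. \<bar>?y k\<bar> powr q) \<le> dyadic_variation q g (Suc n)"
      unfolding dyadic_variation_def power_Suc sum_lessThan_double
      by (intro sum_mono) (simp add: end_eq)
    show "(\<Sum>k<2 ^ n. if k = j then 2 * G * ?V else 0) \<le> 2 * G * ?V"
      using G0 by (simp add: sum.delta)
  qed
  finally show ?thesis .
qed

lemma dyadic_grid_Suc: "dyadic_grid n \<subseteq> dyadic_grid (Suc n)"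
proof
  fix t assume "t \<in> dyadic_grid n"
  then obtain k where "t = dyadic (Suc n) (2 * k)" "2 * k \<le> 2 ^ Suc n"
    by (auto simp: dyadic_grid_def dyadic_double)
  then show "t \<in> dyadic_grid (Suc n)" unfolding dyadic_grid_def by blast
qed

lemma dyadic_grid_level:
  assumes "t \<in> dyadics"
  shows "t \<in> dyadic_grid (dyadic_level t + j)"
proof -
  have "t \<in> dyadic_grid (dyadic_level t)"
    using assms unfolding dyadics_def dyadic_level_def by (auto intro: LeastI)
  then show ?thesis
    using lift_Suc_mono_le[of dyadic_grid, OF dyadic_grid_Suc, of "dyadic_level t" "dyadic_level t + j"]
    by auto
qed

lemma dyadics_subset: "dyadics \<subseteq> {0..1}"
  by (auto simp: dyadics_def dyadic_grid_def dyadic_nonneg dyadic_le_1)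

theorem faber_schauder_integral_exists_if_variation_geometric:
  assumes pq: "p > 1" "q > 1" "1 / p + 1 / q = 1"
    and g: "continuous_on {0..1} g"
    and r: "0 < r" "r < 1" and s: "0 < s" "s < 1"
    and f_var: "\<And>n. dyadic_variation p f n \<le> C * r ^ n"
    and g_var: "\<And>n. dyadic_variation q g n \<le> D * s ^ n"
  shows "faber_schauder_integral_exists f g"
proof -
  have "compact (g ` {0..1})"
    using g by (intro compact_continuous_image) auto
  then obtain G where "\<forall>t\<in>{0..1}. \<bar>g t\<bar> \<le> G"
    by (auto dest!: compact_imp_bounded simp: bounded_iff)
  then have G: "\<bar>g t\<bar> \<le> G" if "t \<in> {0..1}" for t using that by blast
  have G0: "0 \<le> G" using G[of 0] by auto
  have C: "0 \<le> C"
    using dyadic_variation_nonneg[of p f 0] f_var[of 0] by simp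
  let ?P = "\<lambda>n. left_sum_path n f g"
  \<comment> \<open>a summable majorant, uniform in \<open>t\<close>, of the change from level \<open>n\<close> to level \<open>n + 1\<close>\<close>
  define M where "M n = C * r ^ Suc n + D * s ^ Suc n + 2 * G * (C powr (1 / p) * (r powr (1 / p)) ^ Suc n)" for n
  have "summable M"
    unfolding M_def using r s pq
    by (intro summable_add summable_mult) 
       (auto simp: summable_Suc_iff intro!: summable_geometric summable_mult powr_less_one_if_base_less_one)
  moreover have "norm (?P (Suc n) t - ?P n t) \<le> M n" if "t \<in> {0..1}" for n t
  proof -
    have "dyadic_variation p f (Suc n) powr (1 / p) \<le> (C * r ^ Suc n) powr (1 / p)"
      using f_var[of "Suc n"] pq by (intro powr_mono2) (auto simp: dyadic_variation_nonneg)
    also have "\<dots> = C powr (1 / p) * (r powr (1 / p)) ^ Suc n"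
      using C r by (simp only: powr_mult power_powr_swap)
    finally have "dyadic_variation p f (Suc n) + dyadic_variation q g (Suc n)
      + 2 * G * dyadic_variation p f (Suc n) powr (1 / p) \<le> M n"
      unfolding M_def using f_var[of "Suc n"] g_var[of "Suc n"] G0
      by (intro add_mono mult_left_mono) auto
    with left_sum_path_refine_bound[where g = g and n = n and f = f, OF pq that G] show ?thesis by auto
  qed
  ultimately have "uniformly_convergent_on {0..1} (\<lambda>n t. \<Sum>i<n. ?P (Suc i) t - ?P i t)"
    by (intro Weierstrass_m_test')
  then obtain L where L: "uniform_limit {0..1} (\<lambda>n t. \<Sum>i<n. ?P (Suc i) t - ?P i t) L sequentially"
    by (auto simp: uniformly_convergent_on_def)
  define F where "F t = ?P 0 t + L t" for t
  have "uniform_limit {0..1} (\<lambda>n t. ?P 0 t + (\<Sum>i<n. ?P (Suc i) t - ?P i t)) F sequentially"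
    unfolding F_def by (intro uniform_limit_add uniform_limit_const L)
  then have lim: "uniform_limit {0..1} ?P F sequentially"
    by (simp add: sum_lessThan_telescope[where f = "\<lambda>n. left_sum_path n f g t" for t])
  have "continuous_on {0..1} F"
    by (rule uniform_limit_theorem[OF _ lim]) (simp_all add: continuous_on_left_sum_path[OF g])
  moreover have "(\<lambda>j. dyadic_left_sum (dyadic_level t + j) t f g) \<longlonglongrightarrow> F t" if t: "t \<in> dyadics" for t
  proof -
    have "(\<lambda>n. ?P n t) \<longlonglongrightarrow> F t"
      using lim t dyadics_subset by (auto intro: tendsto_uniform_limitI)
    then have "(\<lambda>j. ?P (j + dyadic_level t) t) \<longlonglongrightarrow> F t"
      by (rule LIMSEQ_ignore_initial_segment)
    then show ?thesis
      using dyadic_grid_level[OF t] by (simp add: left_sum_path_eq add.commute)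
  qed
  ultimately show ?thesis
    unfolding faber_schauder_integral_exists_def dyadic_integral_exists_def dyadic_integral_def
    by (metis convergentI limI)
qed

section \<open>Gaussian variables\<close>

lemma gaussian_variable_measurable:
  "gaussian_variable M Z \<Longrightarrow> Z \<in> borel_measurable M"
  unfolding gaussian_variable_def by (auto dest: distributed_measurable)

context prob_space
begin

text \<open>
  Gaussianity of the marginals is what makes the given means and covariances informative: the
  Bochner integral of a function that is not integrable is \<open>0\<close> by convention.
\<close>

lemma gaussian_variable_square_integrable:
  assumes Z: "gaussian_variable M Z"
  shows "integrable M (\<lambda>\<omega>. (Z \<omega>)\<^sup>2)"
proof -
  have [measurable]: "Z \<in> borel_measurable M"
    by (rule gaussian_variable_measurable[OF Z])
  obtain \<mu> where \<mu>: "integrable M (\<lambda>\<omega>. (Z \<omega> - \<mu>)\<^sup>2)"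
  proof -
    from Z consider (normal) \<mu> \<sigma> where "\<sigma> > 0" "distributed M lborel Z (normal_density \<mu> \<sigma>)"
      | (const) \<mu> where "AE \<omega> in M. Z \<omega> = \<mu>"
      unfolding gaussian_variable_def by blast
    then show thesis
    proof cases
      case normal
      then have "integrable M (\<lambda>\<omega>. (Z \<omega> - \<mu>)\<^sup>2)"
        using distributed_integrable[OF normal(2), of "\<lambda>x. (x - \<mu>)\<^sup>2"] integrable_normal_moment[of \<sigma> \<mu> 2]
        by simp
      then show thesis by (rule that)
    next
      case const
      then have "integrable M (\<lambda>\<omega>. (Z \<omega> - \<mu>)\<^sup>2) \<longleftrightarrow> integrable M (\<lambda>\<omega>. 0 :: real)"
        by (intro integrable_cong_AE) auto
      then show thesis by (intro that) simp
    qed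
  qed
  show ?thesis
  proof (rule Bochner_Integration.integrable_bound)
    show "integrable M (\<lambda>\<omega>. 2 * (Z \<omega> - \<mu>)\<^sup>2 + 2 * \<mu>\<^sup>2)"
      using \<mu> by simp
    show "AE \<omega> in M. norm ((Z \<omega>)\<^sup>2) \<le> norm (2 * (Z \<omega> - \<mu>)\<^sup>2 + 2 * \<mu>\<^sup>2)"
    proof (rule AE_I2)
      fix \<omega>
      have "0 \<le> (Z \<omega> - 2 * \<mu>)\<^sup>2" by simp
      then show "norm ((Z \<omega>)\<^sup>2) \<le> norm (2 * (Z \<omega> - \<mu>)\<^sup>2 + 2 * \<mu>\<^sup>2)"
        by (simp add: power2_eq_square algebra_simps)
    qed
  qed simp
qed

lemma integrable_product_of_squares:
  fixes U V :: "'a \<Rightarrow> real"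
  assumes [measurable]: "U \<in> borel_measurable M" "V \<in> borel_measurable M"
    and "integrable M (\<lambda>\<omega>. (U \<omega>)\<^sup>2)" "integrable M (\<lambda>\<omega>. (V \<omega>)\<^sup>2)"
  shows "integrable M (\<lambda>\<omega>. U \<omega> * V \<omega>)"
proof (rule Bochner_Integration.integrable_bound)
  show "integrable M (\<lambda>\<omega>. (U \<omega>)\<^sup>2 + (V \<omega>)\<^sup>2)" using assms by simp
  have "\<bar>u * v\<bar> \<le> u\<^sup>2 + v\<^sup>2" for u v :: real
  proof -
    have "2 * \<bar>u\<bar> * \<bar>v\<bar> \<le> u\<^sup>2 + v\<^sup>2"
      using sum_squares_bound[of "\<bar>u\<bar>" "\<bar>v\<bar>"] by simp
    then show ?thesis
      using mult_nonneg_nonneg[of "\<bar>u\<bar>" "\<bar>v\<bar>"] unfolding abs_mult by linarith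
  qed
  then show "AE \<omega> in M. norm (U \<omega> * V \<omega>) \<le> norm ((U \<omega>)\<^sup>2 + (V \<omega>)\<^sup>2)"
    by auto
qed simp

text \<open>A positive variance excludes the degenerate case of a point mass.\<close>

lemma centered_gaussian_standardized:
  assumes Z: "gaussian_variable M Z" and mean: "expectation Z = 0"
    and var: "expectation (\<lambda>\<omega>. (Z \<omega>)\<^sup>2) = v" and v: "0 < v"
  shows "distributed M lborel (\<lambda>\<omega>. Z \<omega> / sqrt v) std_normal_density"
  using Z unfolding gaussian_variable_def
proof (elim disjE exE conjE)
  fix \<mu> \<sigma> :: real assume \<sigma>: "0 < \<sigma>" and D: "distributed M lborel Z (normal_density \<mu> \<sigma>)"
  have \<mu>: "\<mu> = 0"
    using normal_distributed_expectation[OF \<sigma> D] mean by simp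
  have "v = \<sigma>\<^sup>2"
    using normal_distributed_variance[OF \<sigma> D] mean var by simp
  then have "sqrt v = \<sigma>" using \<sigma> by simp
  then show ?thesis
    using normal_standard_normal_convert[OF \<sigma>, of Z \<mu>] D \<mu> by simp
next
  fix \<mu> assume [measurable]: "Z \<in> borel_measurable M" and ae: "AE \<omega> in M. Z \<omega> = \<mu>"
  have "expectation Z = expectation (\<lambda>_. \<mu>)"
    using ae by (intro integral_cong_AE) auto
  then have "\<mu> = 0" using mean by (simp add: prob_space)
  then have "expectation (\<lambda>\<omega>. (Z \<omega>)\<^sup>2) = expectation (\<lambda>_. 0)"
    using ae by (intro integral_cong_AE) auto
  then show ?thesis using var v by simp
qed

end

lemma integrable_std_normal_abs_powr:
  assumes "0 < p"
  shows "integrable lborel (\<lambda>x. std_normal_density x * \<bar>x\<bar> powr p)"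
proof (rule Bochner_Integration.integrable_bound)
  let ?k = "nat \<lceil>p\<rceil>"
  show "integrable lborel (\<lambda>x. std_normal_density x * \<bar>x\<bar> ^ 0 + std_normal_density x * \<bar>x\<bar> ^ ?k)"
    by (intro Bochner_Integration.integrable_add integrable_std_normal_moment_abs)
  have "\<bar>x\<bar> powr p \<le> 1 + \<bar>x\<bar> ^ ?k" for x :: real
  proof (cases "\<bar>x\<bar> \<le> 1")
    case True
    then have "\<bar>x\<bar> powr p \<le> 1" using assms by (intro powr_le1) auto
    then show ?thesis by (simp add: add_increasing2)
  next
    case False
    then have "\<bar>x\<bar> powr p \<le> \<bar>x\<bar> powr real ?k" using assms by (intro powr_mono) auto
    then show ?thesis using False by (simp add: powr_realpow)
  qed
  then have "std_normal_density x * \<bar>x\<bar> powr p \<le> std_normal_density x * (1 + \<bar>x\<bar> ^ ?k)" for x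
    by (intro mult_left_mono) auto
  then show "AE x in lborel. norm (std_normal_density x * \<bar>x\<bar> powr p)
      \<le> norm (std_normal_density x * \<bar>x\<bar> ^ 0 + std_normal_density x * \<bar>x\<bar> ^ ?k)"
    by (simp add: algebra_simps abs_mult)
qed simp

definition std_normal_abs_moment :: "real \<Rightarrow> real"
  where "std_normal_abs_moment p = (\<integral>x. std_normal_density x * \<bar>x\<bar> powr p \<partial>lborel)"

lemma std_normal_abs_moment_nonneg: "0 \<le> std_normal_abs_moment p"
  unfolding std_normal_abs_moment_def by (intro Bochner_Integration.integral_nonneg) auto

section \<open>Increments of fractional Brownian motion\<close>

locale fbm = prob_space M for M :: "'w measure" +
  fixes H :: real and X :: "real \<Rightarrow> 'w \<Rightarrow> real"
  assumes fbm: "fractional_brownian_motion M H X" and H: "0 < H" "H < 1"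
begin

lemma gaussian_combination:
  "finite F \<Longrightarrow> F \<subseteq> {0..1} \<Longrightarrow> gaussian_variable M (\<lambda>\<omega>. \<Sum>t\<in>F. c t * X t \<omega>)"
  using fbm unfolding fractional_brownian_motion_def centered_gaussian_process_def by blast

lemma expectation_eq_0: "t \<in> {0..1} \<Longrightarrow> expectation (X t) = 0"
  using fbm unfolding fractional_brownian_motion_def centered_gaussian_process_def by blast

lemma covariance:
  "s \<in> {0..1} \<Longrightarrow> t \<in> {0..1} \<Longrightarrow>
    expectation (\<lambda>\<omega>. X s \<omega> * X t \<omega>) = (s powr (2 * H) + t powr (2 * H) - \<bar>t - s\<bar> powr (2 * H)) / 2"
  using fbm unfolding fractional_brownian_motion_def by blast

lemma gaussian_marginal: "t \<in> {0..1} \<Longrightarrow> gaussian_variable M (X t)"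
  using gaussian_combination[of "{t}" "\<lambda>_. 1"] by simp

lemma marginal_measurable: "t \<in> {0..1} \<Longrightarrow> X t \<in> borel_measurable M"
  by (rule gaussian_variable_measurable[OF gaussian_marginal])

lemma marginal_integrable: "t \<in> {0..1} \<Longrightarrow> integrable M (X t)"
  by (rule square_integrable_imp_integrable[OF marginal_measurable
        gaussian_variable_square_integrable[OF gaussian_marginal]])

lemma product_integrable:
  "s \<in> {0..1} \<Longrightarrow> t \<in> {0..1} \<Longrightarrow> integrable M (\<lambda>\<omega>. X s \<omega> * X t \<omega>)"
  by (intro integrable_product_of_squares marginal_measurable
      gaussian_variable_square_integrable gaussian_marginal)

lemma increment_std_normal:
  assumes "a \<in> {0..1}" "b \<in> {0..1}" "a < b"
  shows "distributed M lborel (\<lambda>\<omega>. (X b \<omega> - X a \<omega>) / (b - a) powr H) std_normal_density"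
proof -
  have "gaussian_variable M (\<lambda>\<omega>. X b \<omega> - X a \<omega>)"
    using gaussian_combination[of "{a, b}" "\<lambda>u. if u = b then 1 else - 1"] assms by simp
  moreover have "expectation (\<lambda>\<omega>. X b \<omega> - X a \<omega>) = 0"
    using assms by (simp add: marginal_integrable expectation_eq_0)
  moreover have "expectation (\<lambda>\<omega>. (X b \<omega> - X a \<omega>)\<^sup>2) = (b - a) powr (2 * H)"
  proof -
    have "expectation (\<lambda>\<omega>. (X b \<omega> - X a \<omega>)\<^sup>2)
        = expectation (\<lambda>\<omega>. X b \<omega> * X b \<omega> + X a \<omega> * X a \<omega> - 2 * (X a \<omega> * X b \<omega>))"
      by (intro Bochner_Integration.integral_cong) (auto simp: power2_eq_square algebra_simps)
    also have "\<dots> = (b - a) powr (2 * H)"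
      using assms by (simp add: product_integrable covariance)
        (simp add: add_divide_distrib diff_divide_distrib)
    finally show ?thesis .
  qed
  ultimately have "distributed M lborel (\<lambda>\<omega>. (X b \<omega> - X a \<omega>) / sqrt ((b - a) powr (2 * H))) std_normal_density"
    using assms by (intro centered_gaussian_standardized) auto
  moreover have "sqrt ((b - a) powr (2 * H)) = (b - a) powr H"
    using assms by (simp add: powr_half_sqrt[symmetric] powr_powr)
  ultimately show ?thesis by simp
qed

text \<open>
  The standard deviation of the second difference with step one; with step \<open>h\<close> it is
  \<open>\<kappa> * h powr H\<close> by self-similarity. It is positive because $H < 1$.
\<close>

definition \<kappa> :: real where "\<kappa> = sqrt (4 - 2 powr (2 * H))"

lemma \<kappa>_pos: "0 < \<kappa>"
proof -
  have "2 powr (2 * H) < 2 powr 2"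
    using H by (intro powr_less_mono) auto
  then show ?thesis by (simp add: \<kappa>_def)
qed

lemma second_difference_std_normal:
  assumes "0 < h" "m - h \<in> {0..1}" "m + h \<in> {0..1}"
  shows "distributed M lborel (\<lambda>\<omega>. (2 * X m \<omega> - X (m - h) \<omega> - X (m + h) \<omega>) / (\<kappa> * h powr H))
    std_normal_density"
proof -
  \<comment> \<open>abstract names for the endpoints keep the arguments of the covariance from being rewritten\<close>
  define a b where "a = m - h" and "b = m + h"
  have in01: "a \<in> {0..1}" "m \<in> {0..1}" "b \<in> {0..1}" and ne: "a \<noteq> m" "m \<noteq> b" "a \<noteq> b"
    using assms by (auto simp: a_def b_def)
  let ?Z = "\<lambda>\<omega>. 2 * X m \<omega> - X a \<omega> - X b \<omega>"
  let ?v = "(4 - 2 powr (2 * H)) * h powr (2 * H)"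
  have "gaussian_variable M ?Z"
    using gaussian_combination[of "{m, a, b}" "\<lambda>u. if u = m then 2 else - 1"] in01 ne
    by (simp add: algebra_simps)
  moreover have "expectation ?Z = 0"
    using in01 by (simp add: marginal_integrable expectation_eq_0)
  moreover have "expectation (\<lambda>\<omega>. (?Z \<omega>)\<^sup>2) = ?v"
  proof -
    have "expectation (\<lambda>\<omega>. (?Z \<omega>)\<^sup>2)
        = expectation (\<lambda>\<omega>. 4 * (X m \<omega> * X m \<omega>) + X a \<omega> * X a \<omega> + X b \<omega> * X b \<omega>
            - 4 * (X a \<omega> * X m \<omega>) - 4 * (X m \<omega> * X b \<omega>) + 2 * (X a \<omega> * X b \<omega>))"
      by (intro Bochner_Integration.integral_cong) (auto simp: power2_eq_square algebra_simps)
    also have "\<dots> = 2 * \<bar>m - a\<bar> powr (2 * H) + 2 * \<bar>b - m\<bar> powr (2 * H) - \<bar>b - a\<bar> powr (2 * H)"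
      using in01 by (simp add: product_integrable covariance)
        (simp add: add_divide_distrib diff_divide_distrib)
    also have "\<dots> = ?v"
      using assms by (simp add: a_def b_def powr_mult algebra_simps flip: mult_2)
    finally show ?thesis .
  qed
  moreover have "0 < ?v"
    using \<kappa>_pos assms by (simp add: \<kappa>_def)
  ultimately have "distributed M lborel (\<lambda>\<omega>. ?Z \<omega> / sqrt ?v) std_normal_density"
    by (intro centered_gaussian_standardized) auto
  moreover have "sqrt ?v = \<kappa> * h powr H"
    using assms by (simp add: \<kappa>_def real_sqrt_mult powr_half_sqrt[symmetric] powr_powr)
  ultimately show ?thesis by (simp add: a_def b_def)
qed

lemma increment_abs_moment:
  assumes p: "0 < p" and k: "k < 2 ^ n"
  shows "integrable M (\<lambda>\<omega>. \<bar>X (dyadic n (k + 1)) \<omega> - X (dyadic n k) \<omega>\<bar> powr p)" (is ?I)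
    and "expectation (\<lambda>\<omega>. \<bar>X (dyadic n (k + 1)) \<omega> - X (dyadic n k) \<omega>\<bar> powr p)
      = (2 powr (- (H * p))) ^ n * std_normal_abs_moment p" (is ?E)
proof -
  let ?D = "\<lambda>\<omega>. X (dyadic n (k + 1)) \<omega> - X (dyadic n k) \<omega>"
  let ?N = "\<lambda>\<omega>. ?D \<omega> / (1 / 2 ^ n) powr H"
  have N: "distributed M lborel ?N std_normal_density"
  proof -
    have "dyadic n k \<in> {0..1}" "dyadic n (k + 1) \<in> {0..1}" "dyadic n k < dyadic n (k + 1)"
      using k less_trans[OF dyadic_midpoint_bounds] by (auto simp: dyadic_nonneg dyadic_le_1)
    from increment_std_normal[OF this] show ?thesis
      by (simp only: dyadic_diff)
  qed
  have eq: "\<bar>?D \<omega>\<bar> powr p = (2 powr (- (H * p))) ^ n * \<bar>?N \<omega>\<bar> powr p" for \<omega>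
  proof -
    have "?D \<omega> = (1 / 2 ^ n) powr H * ?N \<omega>" by simp
    then have "\<bar>?D \<omega>\<bar> powr p = ((1 / 2 ^ n) powr H) powr p * \<bar>?N \<omega>\<bar> powr p"
      by (metis abs_mult abs_of_nonneg powr_ge_zero powr_mult abs_ge_zero)
    also have "((1 / 2 ^ n) powr H) powr p = (2 powr (- (H * p))) ^ n"
    proof -
      have "(1 / 2 ^ n :: real) = (1 / 2) ^ n" by (simp add: power_one_over)
      then have "((1 / 2 ^ n :: real) powr H) powr p = ((1 / 2) ^ n) powr (H * p)"
        by (simp only: powr_powr)
      also have "\<dots> = ((1 / 2) powr (H * p)) ^ n"
        by (rule power_powr_swap) simp
      finally have "((1 / 2 ^ n :: real) powr H) powr p = ((1 / 2) powr (H * p)) ^ n" .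
      then show ?thesis by (simp add: powr_minus powr_divide inverse_eq_divide)
    qed
    finally show ?thesis .
  qed
  have "integrable M (\<lambda>\<omega>. \<bar>?N \<omega>\<bar> powr p)"
    using distributed_integrable[OF N, of "\<lambda>x. \<bar>x\<bar> powr p"] integrable_std_normal_abs_powr[OF p] by simp
  then show ?I unfolding eq by simp
  have "expectation (\<lambda>\<omega>. \<bar>?N \<omega>\<bar> powr p) = std_normal_abs_moment p"
    using distributed_integral[OF N, of "\<lambda>x. \<bar>x\<bar> powr p"] by (simp add: std_normal_abs_moment_def)
  then show ?E unfolding eq by simp
qed

section \<open>Energy spaces and the Hurst index\<close>

text \<open>
  There are $2^n$ increments, each contributing a multiple of $2^{-nHp}$, which leaves
  $2^{n(1-Hp)}$.
\<close>

lemma nn_integral_dyadic_variation: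
  assumes p: "0 < p"
  shows "(\<lambda>\<omega>. dyadic_variation p (sample_path X \<omega>) n) \<in> borel_measurable M" (is ?M)
    and "(\<integral>\<^sup>+\<omega>. ennreal (dyadic_variation p (sample_path X \<omega>) n) \<partial>M)
      = ennreal (std_normal_abs_moment p * (2 powr (1 - H * p)) ^ n)" (is ?E)
proof -
  have int: "integrable M (\<lambda>\<omega>. dyadic_variation p (sample_path X \<omega>) n)"
    unfolding dyadic_variation_def sample_path_def
    using increment_abs_moment(1)[OF p] by (intro Bochner_Integration.integrable_sum) auto
  then show ?M by auto
  have "expectation (\<lambda>\<omega>. dyadic_variation p (sample_path X \<omega>) n)
      = (\<Sum>k<(2::nat) ^ n. (2 powr (- (H * p))) ^ n * std_normal_abs_moment p)"
    unfolding dyadic_variation_def sample_path_def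
    using increment_abs_moment[OF p]
    by (subst Bochner_Integration.integral_sum) (auto intro!: sum.cong)
  also have "\<dots> = std_normal_abs_moment p * (2 * 2 powr (- (H * p))) ^ n"
    by (simp add: power_mult_distrib)
  also have "2 * 2 powr (- (H * p)) = 2 powr (1 - H * p)"
    by (simp add: powr_diff powr_minus divide_inverse)
  finally show ?E
    using int by (subst nn_integral_eq_integral) (auto simp: dyadic_variation_nonneg)
qed

text \<open>
  The expected variation decays like $\rho^n$ with $\rho = 2^{1-Hp} < 1$. Dividing by
  $\rho^{n/2}$ keeps the expectations summable, so the sum over all levels of the rescaled
  variations is almost surely finite and bounds each of its terms.
\<close>

theorem AE_dyadic_variation_geometric:
  assumes p: "0 < p" "1 < H * p"
  shows "\<exists>r. 0 < r \<and> r < 1 \<and> (AE \<omega> in M. \<exists>C. \<forall>n. dyadic_variation p (sample_path X \<omega>) n \<le> C * r ^ n)"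
proof (intro exI conjI)
  define r where "r = 2 powr ((1 - H * p) / 2)"
  show r: "0 < 2 powr ((1 - H * p) / 2)" "2 powr ((1 - H * p) / 2) < 1"
    using p powr_less_mono[of "(1 - H * p) / 2" 0 2] by auto
  have rr: "2 powr (1 - H * p) = r * r"
    by (simp add: r_def flip: powr_add)
  let ?V = "\<lambda>n \<omega>. dyadic_variation p (sample_path X \<omega>) n"
  note [measurable] = nn_integral_dyadic_variation(1)[OF p(1)]
  have "(\<integral>\<^sup>+\<omega>. (\<Sum>n. ennreal (?V n \<omega> / r ^ n)) \<partial>M) = (\<Sum>n. \<integral>\<^sup>+\<omega>. ennreal (?V n \<omega> / r ^ n) \<partial>M)"
    by (rule nn_integral_suminf) measurable
  also have "\<dots> = (\<Sum>n. ennreal (std_normal_abs_moment p * r ^ n))"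
  proof (rule suminf_cong)
    fix n
    have "(\<integral>\<^sup>+\<omega>. ennreal (?V n \<omega> / r ^ n) \<partial>M) = (\<integral>\<^sup>+\<omega>. ennreal (1 / r ^ n) * ennreal (?V n \<omega>) \<partial>M)"
      by (intro nn_integral_cong) (simp add: r_def dyadic_variation_nonneg flip: ennreal_mult)
    also have "\<dots> = ennreal (1 / r ^ n) * ennreal (std_normal_abs_moment p * (r * r) ^ n)"
      by (subst nn_integral_cmult) (auto simp: nn_integral_dyadic_variation(2)[OF p(1)] rr)
    also have "\<dots> = ennreal (std_normal_abs_moment p * r ^ n)"
      using r by (subst ennreal_mult[symmetric])
        (auto simp: std_normal_abs_moment_nonneg r_def power_mult_distrib)
    finally show "(\<integral>\<^sup>+\<omega>. ennreal (?V n \<omega> / r ^ n) \<partial>M) = ennreal (std_normal_abs_moment p * r ^ n)" .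
  qed
  also have "\<dots> \<noteq> top"
    using r by (intro ennreal_suminf_neq_top summable_mult summable_geometric)
      (auto simp: r_def std_normal_abs_moment_nonneg)
  finally have "AE \<omega> in M. (\<Sum>n. ennreal (?V n \<omega> / r ^ n)) \<noteq> \<infinity>"
    by (intro nn_integral_PInf_AE) auto
  then show "AE \<omega> in M. \<exists>C. \<forall>n. ?V n \<omega> \<le> C * (2 powr ((1 - H * p) / 2)) ^ n"
  proof eventually_elim
    fix \<omega> assume fin: "(\<Sum>n. ennreal (?V n \<omega> / r ^ n)) \<noteq> \<infinity>"
    have "?V n \<omega> \<le> enn2real (\<Sum>n. ennreal (?V n \<omega> / r ^ n)) * r ^ n" for n
    proof -
      have "ennreal (?V n \<omega> / r ^ n) \<le> (\<Sum>n. ennreal (?V n \<omega> / r ^ n))"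
        using sum_le_suminf[of "\<lambda>n. ennreal (?V n \<omega> / r ^ n)" "{n}"] by (simp add: summableI)
      then have "?V n \<omega> / r ^ n \<le> enn2real (\<Sum>n. ennreal (?V n \<omega> / r ^ n))"
        using fin enn2real_mono[of "ennreal (?V n \<omega> / r ^ n)" "\<Sum>n. ennreal (?V n \<omega> / r ^ n)"]
        by (simp add: less_top r_def dyadic_variation_nonneg)
      then show ?thesis by (simp add: r_def divide_le_eq)
    qed
    then show "\<exists>C. \<forall>n. ?V n \<omega> \<le> C * (2 powr ((1 - H * p) / 2)) ^ n"
      unfolding r_def by blast
  qed
qed

text \<open>
  If $Hp \<le> 1$, the variance of the second differences is so large that the \<open>p\<close>-th power of the
  level energy dominates an average over the level of standard normal
  functionals. Its truncation at one has a positive expectation that is the same at every level,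
  which by dominated convergence rules out almost sure convergence to zero.
\<close>

theorem exponent_gt_if_AE_energy_space:
  assumes p: "0 < p" and ae: "AE \<omega> in M. sample_path X \<omega> \<in> energy_space p"
  shows "1 < H * p"
proof (rule ccontr)
  assume "\<not> 1 < H * p"
  then have Hp: "H * p \<le> 1" by simp
  \<comment> \<open>\<open>h n\<close> is half the length of a level-\<open>n\<close> interval\<close>
  define h where "h n = (1 / 2 :: real) ^ Suc n" for n :: nat
  define G where "G n k \<omega> = second_difference (sample_path X \<omega>) n k / (\<kappa> * h n powr H)" for n k \<omega>
  define \<phi> where "\<phi> x = min 1 (\<bar>x\<bar> powr p)" for x :: real
  define c where "c = (\<integral>x. std_normal_density x * \<phi> x \<partial>lborel)"
  define B where "B n \<omega> = (\<Sum>k<2 ^ n. \<phi> (G n k \<omega>)) / 2 ^ n" for n \<omega>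
  have G: "distributed M lborel (G n k) std_normal_density" if k: "k < 2 ^ n" for n k
  proof -
    define m where "m = dyadic (Suc n) (2 * k + 1)"
    have a: "m - h n = dyadic n k" and b: "m + h n = dyadic n (k + 1)"
      by (auto simp: m_def h_def dyadic_def field_simps)
    have "dyadic n k \<in> {0..1}" "dyadic n (k + 1) \<in> {0..1}"
      using k by (auto simp: dyadic_nonneg dyadic_le_1)
    then show ?thesis
      using second_difference_std_normal[of "h n" m] unfolding a b
      by (simp add: G_def[abs_def] h_def second_difference_def sample_path_def m_def)
  qed
  have \<phi>_meas [measurable]: "\<phi> \<in> borel_measurable borel"
    unfolding \<phi>_def by measurable
  have G_meas: "G n k \<in> borel_measurable M" if "k < 2 ^ n" for n k
    using distributed_measurable[OF G[OF that]] by simp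
  have E\<phi>: "expectation (\<lambda>\<omega>. \<phi> (G n k \<omega>)) = c" if "k < 2 ^ n" for n k
    using distributed_integral[OF G[OF that], of \<phi>] by (simp add: c_def)
  have \<phi>_bounds: "0 \<le> \<phi> x" "\<phi> x \<le> 1" for x
    by (auto simp: \<phi>_def)
  have \<phi>_int: "integrable M (\<lambda>\<omega>. \<phi> (G n k \<omega>))" if "k < 2 ^ n" for n k
    using \<phi>_bounds measurable_compose[OF G_meas[OF that] \<phi>_meas]
    by (intro integrable_const_bound[where B = 1]) auto
  have B_bounds: "0 \<le> B n \<omega>" "B n \<omega> \<le> 1" for n \<omega>
    using sum_bounded_above[of "{..<2 ^ n}" "\<lambda>k. \<phi> (G n k \<omega>)" 1] \<phi>_bounds
    by (auto simp: B_def sum_nonneg divide_le_eq)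
  have "expectation (B n) = c" for n
    unfolding B_def using \<phi>_int E\<phi> by (simp add: Bochner_Integration.integral_sum)
  moreover have "(\<lambda>n. expectation (B n)) \<longlonglongrightarrow> expectation (\<lambda>_. 0)"
  proof (rule integral_dominated_convergence[where w = "\<lambda>_. 1"])
    show "B n \<in> borel_measurable M" for n
      unfolding B_def[abs_def] using measurable_compose[OF G_meas \<phi>_meas]
      by (intro borel_measurable_divide borel_measurable_sum) auto
    show "AE \<omega> in M. norm (B n \<omega>) \<le> 1" for n
      using B_bounds by auto
    show "AE \<omega> in M. (\<lambda>n. B n \<omega>) \<longlonglongrightarrow> 0"
      using ae
    proof eventually_elim
      fix \<omega> assume \<omega>: "sample_path X \<omega> \<in> energy_space p"
      let ?Z = "\<lambda>n. \<Sum>k<2 ^ n. \<bar>second_difference (sample_path X \<omega>) n k\<bar> powr p"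
      have B_le: "B n \<omega> \<le> 2 / \<kappa> powr p * ?Z n" for n
      proof -
        \<comment> \<open>a step below one, raised to the exponent \<open>H * p \<le> 1\<close>\<close>
        have hp: "h n \<le> (h n powr H) powr p"
        proof -
          have "h n powr 1 \<le> h n powr (H * p)"
            using Hp by (intro powr_mono') (auto simp: h_def power_le_one simp del: power_Suc)
          then show ?thesis by (simp add: powr_powr h_def)
        qed
        have "\<phi> (G n k \<omega>) * h n \<le> \<bar>second_difference (sample_path X \<omega>) n k\<bar> powr p / \<kappa> powr p" for k
        proof -
          let ?w = "second_difference (sample_path X \<omega>) n k"
          have "\<phi> (G n k \<omega>) * h n \<le> \<bar>G n k \<omega>\<bar> powr p * (h n powr H) powr p"
            using hp by (intro mult_mono) (auto simp: \<phi>_def h_def)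
          also have "\<dots> = (\<bar>G n k \<omega>\<bar> * h n powr H) powr p"
            by (simp add: powr_mult)
          also have "\<bar>G n k \<omega>\<bar> * h n powr H = \<bar>?w\<bar> / \<kappa>"
            using \<kappa>_pos by (simp add: G_def abs_mult h_def)
          also have "(\<bar>?w\<bar> / \<kappa>) powr p = \<bar>?w\<bar> powr p / \<kappa> powr p"
            using \<kappa>_pos by (simp add: powr_divide)
          finally show ?thesis .
        qed
        then have "(\<Sum>k<2 ^ n. \<phi> (G n k \<omega>) * h n)
            \<le> (\<Sum>k<2 ^ n. \<bar>second_difference (sample_path X \<omega>) n k\<bar> powr p / \<kappa> powr p)"
          by (rule sum_mono)
        moreover have "(\<Sum>k<2 ^ n. \<phi> (G n k \<omega>) * h n) = B n \<omega> / 2"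
          unfolding sum_distrib_right[symmetric] by (simp add: B_def h_def power_one_over)
        ultimately show ?thesis
          by (simp add: mult.commute flip: sum_divide_distrib)
      qed
      have lim: "(\<lambda>n. 2 / \<kappa> powr p * ?Z n) \<longlonglongrightarrow> 0"
        by (rule tendsto_mult_right_zero[OF second_difference_sums_tendsto_0[OF \<omega> p]])
      show "(\<lambda>n. B n \<omega>) \<longlonglongrightarrow> 0"
        by (rule tendsto_sandwich[OF _ _ tendsto_const lim]) (simp_all only: B_bounds B_le eventually_True)
    qed
  qed auto
  ultimately have "c = 0"
    by (simp add: LIMSEQ_const_iff)
  then have "expectation (\<lambda>\<omega>. \<phi> (G 0 0 \<omega>)) = 0"
    using E\<phi>[of 0 0] by simp
  \<comment> \<open>a vanishing expectation would make a standard normal variable vanish almost surely\<close>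
  then have "AE \<omega> in M. \<phi> (G 0 0 \<omega>) = 0"
    using integral_nonneg_eq_0_iff_AE[OF \<phi>_int[of 0 0]] \<phi>_bounds by simp
  then have "AE \<omega> in M. G 0 0 \<omega> = 0"
    by eventually_elim (auto simp: \<phi>_def min_def split: if_splits)
  moreover have "expectation (G 0 0) = 0" "variance (G 0 0) = 1"
    using G[of 0 0] standard_normal_distributed_expectation standard_normal_distributed_variance by auto
  moreover have "expectation (\<lambda>\<omega>. (G 0 0 \<omega>)\<^sup>2) = expectation (\<lambda>_. 0)" if "AE \<omega> in M. G 0 0 \<omega> = 0"
    using that G_meas[of 0 0] by (intro integral_cong_AE) auto
  ultimately show False by simp
qed

end

section \<open>Complementary Hurst indices and conjugate energy spaces\<close>
theorem corollary4p10:
  fixes M :: "'w measure"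
    and X Y :: "real \<Rightarrow> 'w \<Rightarrow> real"
    and H1 H2 :: real
  assumes "prob_space M"
    and "0 < H1" "H1 < 1"
    and "0 < H2" "H2 < 1"
    and "fractional_brownian_motion M H1 X"
    and "fractional_brownian_motion M H2 Y"
    and "\<And>\<omega>. \<omega> \<in> space M \<Longrightarrow> continuous_on {0..1} (sample_path X \<omega>)"
    and "\<And>\<omega>. \<omega> \<in> space M \<Longrightarrow> continuous_on {0..1} (sample_path Y \<omega>)"
  shows "(H1 + H2 > 1 \<longleftrightarrow>
           (\<exists>p q :: real. p > 1 \<and> q > 1 \<and> 1 / p + 1 / q = 1 \<and>
              (AE \<omega> in M. sample_path X \<omega> \<in> energy_space p \<and> sample_path Y \<omega> \<in> energy_space q)))
       \<and> (H1 + H2 > 1 \<longrightarrow>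
           (AE \<omega> in M. faber_schauder_integral_exists (sample_path X \<omega>) (sample_path Y \<omega>) \<and>
                       faber_schauder_integral_exists (sample_path Y \<omega>) (sample_path X \<omega>)))"
proof -
  interpret X: fbm M H1 X
    by (intro fbm.intro fbm_axioms.intro assms)
  interpret Y: fbm M H2 Y
    by (intro fbm.intro fbm_axioms.intro assms)
  have sufficient: "\<exists>p q :: real. p > 1 \<and> q > 1 \<and> 1 / p + 1 / q = 1 \<and>
      (AE \<omega> in M. sample_path X \<omega> \<in> energy_space p \<and> sample_path Y \<omega> \<in> energy_space q \<and>
        faber_schauder_integral_exists (sample_path X \<omega>) (sample_path Y \<omega>) \<and>
        faber_schauder_integral_exists (sample_path Y \<omega>) (sample_path X \<omega>))"
    if H: "H1 + H2 > 1"
  proof -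
    \<comment> \<open>the midpoint of the interval of admissible values for \<open>1 / p\<close>\<close>
    define u where "u = (1 - H2 + H1) / 2"
    define p where "p = 1 / u"
    define q where "q = 1 / (1 - u)"
    have u: "0 < u" "u < 1" "u < H1" "1 - u < H2"
      using H assms by (auto simp: u_def field_simps)
    have pq: "p > 1" "q > 1" "1 / p + 1 / q = 1" "1 < H1 * p" "1 < H2 * q"
      using u by (auto simp: p_def q_def field_simps)
    obtain r where r: "0 < r" "r < 1"
      and X_var: "AE \<omega> in M. \<exists>C. \<forall>n. dyadic_variation p (sample_path X \<omega>) n \<le> C * r ^ n"
      using X.AE_dyadic_variation_geometric[of p] pq by auto
    obtain s where s: "0 < s" "s < 1"
      and Y_var: "AE \<omega> in M. \<exists>D. \<forall>n. dyadic_variation q (sample_path Y \<omega>) n \<le> D * s ^ n"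
      using Y.AE_dyadic_variation_geometric[of q] pq by auto
    from X_var Y_var AE_space
    have "AE \<omega> in M. sample_path X \<omega> \<in> energy_space p \<and> sample_path Y \<omega> \<in> energy_space q \<and>
        faber_schauder_integral_exists (sample_path X \<omega>) (sample_path Y \<omega>) \<and>
        faber_schauder_integral_exists (sample_path Y \<omega>) (sample_path X \<omega>)"
    proof eventually_elim
      fix \<omega> assume "\<exists>C. \<forall>n. dyadic_variation p (sample_path X \<omega>) n \<le> C * r ^ n"
        and "\<exists>D. \<forall>n. dyadic_variation q (sample_path Y \<omega>) n \<le> D * s ^ n" and \<omega>: "\<omega> \<in> space M"
      then obtain C D where C: "\<And>n. dyadic_variation p (sample_path X \<omega>) n \<le> C * r ^ n"
        and D: "\<And>n. dyadic_variation q (sample_path Y \<omega>) n \<le> D * s ^ n" by blast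
      note cont = assms(8)[OF \<omega>] assms(9)[OF \<omega>]
      have "sample_path X \<omega> \<in> energy_space p"
        using pq by (intro energy_space_if_variation_geometric[OF cont(1) _ r C]) auto
      moreover have "sample_path Y \<omega> \<in> energy_space q"
        using pq by (intro energy_space_if_variation_geometric[OF cont(2) _ s D]) auto
      moreover have "faber_schauder_integral_exists (sample_path X \<omega>) (sample_path Y \<omega>)"
        by (rule faber_schauder_integral_exists_if_variation_geometric[OF pq(1-3) cont(2) r s C D])
      moreover have "faber_schauder_integral_exists (sample_path Y \<omega>) (sample_path X \<omega>)"
        using pq by (intro faber_schauder_integral_exists_if_variation_geometric[OF pq(2,1) _ cont(1) s r D C]) auto
      ultimately show "sample_path X \<omega> \<in> energy_space p \<and> sample_path Y \<omega> \<in> energy_space q \<and>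
        faber_schauder_integral_exists (sample_path X \<omega>) (sample_path Y \<omega>) \<and>
        faber_schauder_integral_exists (sample_path Y \<omega>) (sample_path X \<omega>)" by blast
    qed
    with pq show ?thesis by blast
  qed
  have necessary: "H1 + H2 > 1"
    if pq: "p > 1" "q > 1" "1 / p + 1 / q = 1"
      and ae: "AE \<omega> in M. sample_path X \<omega> \<in> energy_space p \<and> sample_path Y \<omega> \<in> energy_space q"
    for p q :: real
  proof -
    have "1 < H1 * p"
      using ae pq by (intro X.exponent_gt_if_AE_energy_space) auto
    then have "1 / p < H1" using pq by (simp add: field_simps)
    moreover have "1 < H2 * q"
      using ae pq by (intro Y.exponent_gt_if_AE_energy_space) auto
    then have "1 / q < H2" using pq by (simp add: field_simps)
    ultimately show ?thesis using pq by linarith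
  qed
  show ?thesis
  proof (intro conjI iffI impI)
    assume "H1 + H2 > 1"
    from sufficient[OF this] obtain p q :: real where "p > 1" "q > 1" "1 / p + 1 / q = 1"
      and ae: "AE \<omega> in M. sample_path X \<omega> \<in> energy_space p \<and> sample_path Y \<omega> \<in> energy_space q \<and>
        faber_schauder_integral_exists (sample_path X \<omega>) (sample_path Y \<omega>) \<and>
        faber_schauder_integral_exists (sample_path Y \<omega>) (sample_path X \<omega>)" by blast
    moreover from ae
    have "AE \<omega> in M. sample_path X \<omega> \<in> energy_space p \<and> sample_path Y \<omega> \<in> energy_space q"
      by eventually_elim blast
    ultimately show "\<exists>p q :: real. p > 1 \<and> q > 1 \<and> 1 / p + 1 / q = 1 \<and>
        (AE \<omega> in M. sample_path X \<omega> \<in> energy_space p \<and> sample_path Y \<omega> \<in> energy_space q)" by blast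
    from ae show "AE \<omega> in M. faber_schauder_integral_exists (sample_path X \<omega>) (sample_path Y \<omega>) \<and>
        faber_schauder_integral_exists (sample_path Y \<omega>) (sample_path X \<omega>)"
      by eventually_elim blast
  next
    assume "\<exists>p q :: real. p > 1 \<and> q > 1 \<and> 1 / p + 1 / q = 1 \<and>
        (AE \<omega> in M. sample_path X \<omega> \<in> energy_space p \<and> sample_path Y \<omega> \<in> energy_space q)"
    then show "H1 + H2 > 1"
      by (elim exE conjE) (rule necessary)
  qed
qed

end
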